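(* The price of anarchy, with respect to liquid welfare, of coarse correlated equilibria of generalized first-price (GFP) auctions with budgets is at most $$\frac{2+\mathcal W_0(-e^{-2})}{1+\mathcal W_0(-e^{-2})}\approx2.188.$$ That is, for every such instance $I$ and every coarse correlated equilibrium $A$ of $I$, $\mathrm{OPT}(I)\le\frac{2+\mathcal W_0(-e^{-2})}{1+\mathcal W_0(-e^{-2})}\,\mathrm{LW}(I,A)$.
   Context: $\mathcal W_0$ is the principal real branch of the Lambert function: $\mathcal W_0(-e^{-2})$ is the unique $w\in[-1,0)$ with $we^w=-e^{-2}$. GFP auction: bidders $N=[n]$, $n\ge2$, and $m\le n$ slots with click-through rates $\alpha_1\ge\alpha_2\ge\dots\ge\alpha_m>0$; set $\alpha_0=0$. Bidder $i$ submits a scalar bid $a_i\in\mathcal A_i=\mathbb R_{\ge0}$; $\mathcal A=\mathbb R_{\ge0}^n$. Bidders are ranked in non-increasing order of bids, ties resolved by a fixed deterministic rule, and slot $j\in[m]$ goes to the $j$-th ranked bidder; $X_i(a)\in\{0,1,\dots,m\}$ is the slot of bidder $i$ ($0$ meaning no slot). Bidder $i$ pays $P_i(a)=\alpha_{X_i(a)}a_i$. Bidder $i$ has a value per click $\bar v_i\ge0$, giving valuation $v_i(j)=\bar v_i\alpha_j$, and a budget $B_i\in(0,\infty]$. Utility: $u_i(a)=v_i(X_i(a))-P_i(a)$. Feasible allocations $\mathcal X$: profiles $x\in\{0,\dots,m\}^n$ in which no slot $j\ge1$ is assigned to two bidders. $\Delta(S)$ denotes probability distributions on $S$. For $A\in\Delta(\mathcal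 A)$ let $A_{-i}$ be the marginal on the others' actions, and let $\mathcal C_i(A_{-i})$ be the set of $A_i'\in\Delta(\mathcal A_i)$ with $\mathbb E_{a_i'\sim A_i',a_{-i}\sim A_{-i}}[P_i(a_i',a_{-i})]\le B_i$ (independent draws). $A\in\Delta(\mathcal A)$ is a coarse correlated equilibrium if for all $i$: $\mathbb E_{a\sim A}[P_i(a)]\le B_i$, and $\mathbb E_{a\sim A}[u_i(a)]\ge\mathbb E_{a_i'\sim A_i',a_{-i}\sim A_{-i}}[u_i(a_i',a_{-i})]$ for all $A_i'\in\mathcal C_i(A_{-i})$. $\mathrm{LW}(I,A)=\sum_i\min\{\mathbb E_{a\sim A}[v_i(X_i(a))],B_i\}$ and $\mathrm{OPT}(I)=\max_{\chi\in\Delta(\mathcal X)}\sum_i\min\{\mathbb E_{x\sim\chi}[v_i(x_i)],B_i\}$. The price of anarchy is the supremum of $\mathrm{OPT}(I)/\mathrm{LW}(I,A)$ over instances $I$ and equilibria $A$. *)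

theory Defs
  imports "HOL-Probability.Probability"
begin

text \<open>Principal real branch of the Lambert function, meaningful for \<open>x \<ge> - exp (- 1)\<close>.\<close>

definition lambert_W0 :: "real \<Rightarrow> real" where
  "lambert_W0 x = (THE w. - 1 \<le> w \<and> w * exp w = x)"

lemma lambert_W0_unique_aux:
  assumes "- 1 \<le> v" "v < (w::real)"
  shows "v * exp v < w * exp w"
proof (rule DERIV_pos_imp_increasing_open[OF assms(2)])
  fix x assume x: "v < x" "x < w"
  have "((\<lambda>x. x * exp x) has_real_derivative (1 + x) * exp x) (at x)"
    by (auto intro!: derivative_eq_intros simp: algebra_simps)
  moreover have "(1 + x) * exp x > 0" using x assms by simp
  ultimately show "\<exists>y. ((\<lambda>x. x * exp x) has_real_derivative y) (at x) \<and> y > 0" by blast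
qed (intro continuous_intros)

lemma lambert_W0_exp_minus_2:
  "- 1 \<le> lambert_W0 (- exp (- 2))" "lambert_W0 (- exp (- 2)) < 0"
  "lambert_W0 (- exp (- 2)) * exp (lambert_W0 (- exp (- 2))) = - exp (- 2)"
proof -
  have "\<exists>w\<ge>-1. w \<le> 0 \<and> w * exp w = - exp (- 2 :: real)"
    by (rule IVT') (auto intro!: continuous_intros)
  then obtain w :: real where w: "- 1 \<le> w" "w * exp w = - exp (- 2)" "w \<le> 0" by blast
  have "lambert_W0 (- exp (- 2)) = w"
    unfolding lambert_W0_def
  proof (rule the_equality)
    fix v :: real assume v: "- 1 \<le> v \<and> v * exp v = - exp (- 2)"
    show "v = w"
      using lambert_W0_unique_aux[of v w] lambert_W0_unique_aux[of w v] v w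
      by (cases v w rule: linorder_cases) auto
  qed (use w in auto)
  moreover have "w \<noteq> 0" using w by auto
  ultimately show "- 1 \<le> lambert_W0 (- exp (- 2))" "lambert_W0 (- exp (- 2)) < 0"
    "lambert_W0 (- exp (- 2)) * exp (lambert_W0 (- exp (- 2))) = - exp (- 2)"
    using w by auto
qed

text \<open>
  Expectation with values in the extended reals. Bids are unbounded, so an expected payment may be
  \<open>\<infinity>\<close> and an expected utility \<open>- \<infinity>\<close>; the Bochner integral would return \<open>0\<close> there. The difference
  is never \<open>\<infinity> - \<infinity>\<close> below, because payments are nonnegative and utilities are bounded above.
\<close>

definition expect :: "'a measure \<Rightarrow> ('a \<Rightarrow> real) \<Rightarrow> ereal" where
  "expect M f = enn2ereal (\<integral>\<^sup>+x. ennreal (f x) \<partial>M) - enn2ereal (\<integral>\<^sup>+x. ennreal (- f x) \<partial>M)"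

lemma expect_eq_integral:
  assumes "integrable M f"
  shows "expect M f = ereal (integral\<^sup>L M f)"
proof -
  from assms obtain r q where rq: "0 \<le> r" "0 \<le> q"
    "(\<integral>\<^sup>+x. ennreal (f x) \<partial>M) = ennreal r" "(\<integral>\<^sup>+x. ennreal (- f x) \<partial>M) = ennreal q"
    "f \<in> borel_measurable M" "integral\<^sup>L M f = r - q"
    by (rule integrableE)
  then show ?thesis by (simp add: expect_def enn2ereal_ennreal)
qed

text \<open>
  Bidders are \<open>{1..bidders}\<close>, slots are \<open>{1..slots}\<close>, and slot \<open>0\<close> stands for no slot.
  \<open>rank_of a i\<close> is the position of bidder \<open>i\<close> under the bid profile \<open>a\<close>; it carries the
  tie-breaking rule.
\<close>

record gfp_auction =
  bidders :: nat
  slots :: nat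
  ctr :: "nat \<Rightarrow> real"
  click_value :: "nat \<Rightarrow> real"
  budget :: "nat \<Rightarrow> ereal"
  rank_of :: "(nat \<Rightarrow> real) \<Rightarrow> nat \<Rightarrow> nat"

definition bid_space :: "real measure" where
  "bid_space = restrict_space borel {0..}"

definition profile_space :: "gfp_auction \<Rightarrow> (nat \<Rightarrow> real) measure" where
  "profile_space I = Pi\<^sub>M {1..bidders I} (\<lambda>_. bid_space)"

definition others_space :: "gfp_auction \<Rightarrow> nat \<Rightarrow> (nat \<Rightarrow> real) measure" where
  "others_space I i = Pi\<^sub>M ({1..bidders I} - {i}) (\<lambda>_. bid_space)"

text \<open>
  The only restrictions on the tie-breaking rule are that higher bids are ranked first and that
  ranks depend measurably on the bids, without which the expectations would be undefined.
\<close>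

definition ranking_rule :: "gfp_auction \<Rightarrow> bool" where
  "ranking_rule I \<longleftrightarrow>
     (\<forall>a\<in>space (profile_space I).
        bij_betw (rank_of I a) {1..bidders I} {1..bidders I} \<and>
        (\<forall>i\<in>{1..bidders I}. \<forall>k\<in>{1..bidders I}. a k < a i \<longrightarrow> rank_of I a i < rank_of I a k)) \<and>
     (\<forall>i\<in>{1..bidders I}. (\<lambda>a. rank_of I a i) \<in> measurable (profile_space I) (count_space UNIV))"

definition gfp_instance :: "gfp_auction \<Rightarrow> bool" where
  "gfp_instance I \<longleftrightarrow>
     2 \<le> bidders I \<and> slots I \<le> bidders I \<and>
     ctr I 0 = 0 \<and>
     (\<forall>j\<in>{1..slots I}. 0 < ctr I j) \<and>
     (\<forall>j\<in>{1..slots I}. \<forall>k\<in>{1..slots I}. j \<le> k \<longrightarrow> ctr I k \<le> ctr I j) \<and>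
     (\<forall>i\<in>{1..bidders I}. 0 \<le> click_value I i) \<and>
     (\<forall>i\<in>{1..bidders I}. 0 < budget I i) \<and>
     ranking_rule I"

definition slot_of :: "gfp_auction \<Rightarrow> nat \<Rightarrow> (nat \<Rightarrow> real) \<Rightarrow> nat" where
  "slot_of I i a = (if rank_of I a i \<le> slots I then rank_of I a i else 0)"

definition payment :: "gfp_auction \<Rightarrow> nat \<Rightarrow> (nat \<Rightarrow> real) \<Rightarrow> real" where
  "payment I i a = ctr I (slot_of I i a) * a i"

definition valuation :: "gfp_auction \<Rightarrow> nat \<Rightarrow> nat \<Rightarrow> real" where
  "valuation I i j = click_value I i * ctr I j"

definition utility :: "gfp_auction \<Rightarrow> nat \<Rightarrow> (nat \<Rightarrow> real) \<Rightarrow> real" where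
  "utility I i a = valuation I i (slot_of I i a) - payment I i a"

definition others_marginal :: "gfp_auction \<Rightarrow> nat \<Rightarrow> (nat \<Rightarrow> real) measure \<Rightarrow> (nat \<Rightarrow> real) measure" where
  "others_marginal I i A =
     distr A (others_space I i) (\<lambda>a. restrict a ({1..bidders I} - {i}))"

definition deviation_expect ::
    "gfp_auction \<Rightarrow> nat \<Rightarrow> real measure \<Rightarrow> (nat \<Rightarrow> real) measure \<Rightarrow> ((nat \<Rightarrow> real) \<Rightarrow> real) \<Rightarrow> ereal" where
  "deviation_expect I i A' A f =
     expect (A' \<Otimes>\<^sub>M others_marginal I i A) (\<lambda>(b, a). f (a(i := b)))"

definition budget_feasible_deviations :: "gfp_auction \<Rightarrow> nat \<Rightarrow> (nat \<Rightarrow> real) measure \<Rightarrow> real measure set" where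
  "budget_feasible_deviations I i A =
     {A' \<in> space (prob_algebra bid_space). deviation_expect I i A' A (payment I i) \<le> budget I i}"

definition coarse_correlated_eq :: "gfp_auction \<Rightarrow> (nat \<Rightarrow> real) measure \<Rightarrow> bool" where
  "coarse_correlated_eq I A \<longleftrightarrow>
     A \<in> space (prob_algebra (profile_space I)) \<and>
     (\<forall>i\<in>{1..bidders I}.
        expect A (payment I i) \<le> budget I i \<and>
        (\<forall>A'\<in>budget_feasible_deviations I i A.
           deviation_expect I i A' A (utility I i) \<le> expect A (utility I i)))"

definition liquid_welfare :: "gfp_auction \<Rightarrow> (nat \<Rightarrow> real) measure \<Rightarrow> ereal" where
  "liquid_welfare I A =
     (\<Sum>i\<in>{1..bidders I}. min (expect A (\<lambda>a. valuation I i (slot_of I i a))) (budget I i))"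

definition feasible_allocations :: "gfp_auction \<Rightarrow> (nat \<Rightarrow> nat) set" where
  "feasible_allocations I =
     {x \<in> {1..bidders I} \<rightarrow>\<^sub>E {0..slots I}.
        \<forall>i\<in>{1..bidders I}. \<forall>k\<in>{1..bidders I}. i \<noteq> k \<and> x i = x k \<longrightarrow> x i = 0}"

text \<open>
  The supremum is a maximum: the objective is continuous in \<open>p\<close> on the compact simplex over the
  finite nonempty set of feasible allocations.
\<close>

definition opt_liquid_welfare :: "gfp_auction \<Rightarrow> ereal" where
  "opt_liquid_welfare I =
     (SUP p\<in>{p :: (nat \<Rightarrow> nat) pmf. set_pmf p \<subseteq> feasible_allocations I}.
        \<Sum>i\<in>{1..bidders I}.
          min (expect (measure_pmf p) (\<lambda>x. valuation I i (x i))) (budget I i))"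

text \<open>In \<^typ>\<open>ereal\<close>, \<open>0 / 0 = 0\<close> and \<open>x / 0 = \<infinity>\<close> for \<open>x > 0\<close>.\<close>

definition price_of_anarchy :: ereal where
  "price_of_anarchy =
     Sup {opt_liquid_welfare I / liquid_welfare I A | I A.
            gfp_instance I \<and> coarse_correlated_eq I A}"

end

theory Submission
  imports Defs
begin

text \<open>
  Let \<open>b\<^sub>j\<close> be the \<open>j\<close>-th highest bid and let a bidder with value \<open>v\<close> per click aim at slot \<open>j\<close> with
  probability \<open>z\<^sub>j\<close>, where \<open>v * (\<Sum>j. z\<^sub>j * \<alpha>\<^sub>j)\<close> is at most the budget. For every \<open>t \<le> v\<close>, bidding \<open>t\<close>
  with a suitable probability and \<open>0\<close> otherwise respects the budget and earns at least
  \<open>(v - t) * (\<Sum>j. z\<^sub>j * \<alpha>\<^sub>j * P(b\<^sub>j < t))\<close>, which is therefore a lower bound on the equilibrium utility.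
  Averaging over \<open>t\<close> with density proportional to \<open>1 / (v - t)\<close> turns this into a bound in terms of
  the target value and \<open>\<Sum>j. z\<^sub>j * \<alpha>\<^sub>j * E b\<^sub>j\<close>. Summed over bidders, the latter is at most the total
  payment. Bidders whose value exceeds their budget already contribute their whole budget to the
  liquid welfare.
\<close>

section \<open>Averaging over fixed bids\<close>

text \<open>At \<open>w = - 1\<close> the defining equation would force
  \<open>exp (- 1) = exp (- 2)\<close>. Strictness makes the denominator \<open>1 + w\<close> of the
  final ratio positive.\<close>

lemma lambert_W0_exp_minus_2_gt: "- 1 < lambert_W0 (- exp (- 2))"
proof (rule ccontr)
  assume "\<not> ?thesis"
  then have "lambert_W0 (- exp (- 2)) = - 1"
    using lambert_W0_exp_minus_2(1) by simp
  with lambert_W0_exp_minus_2(3) show False by simp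
qed

text \<open>Fubini for the indicator of \<open>X x < t\<close> over \<open>{0..T}\<close>: for fixed
  \<open>x\<close> the integral in \<open>t\<close> is the positive part of \<open>T - X x\<close>,
  which dominates \<open>T - X x\<close>.\<close>

lemma (in prob_space) integral_prob_less_ge:
  fixes X :: "'a \<Rightarrow> real"
  assumes X: "integrable M X" and nonneg: "\<And>x. x \<in> space M \<Longrightarrow> 0 \<le> X x" and T: "0 \<le> T"
  shows "integrable lborel (\<lambda>t. prob {x \<in> space M. X x < t} * indicator {0..T} t)"
    and "T - expectation X \<le> (\<integral>t. prob {x \<in> space M. X x < t} * indicator {0..T} t \<partial>lborel)"
proof -
  interpret P: pair_sigma_finite lborel M ..
  have [measurable]: "X \<in> borel_measurable M" using X by auto
  define h :: "real \<times> 'a \<Rightarrow> real" where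
    "h = (\<lambda>(t, x). (if X x < t then 1 else 0) * indicator {0..T} t)"
  have h: "integrable (lborel \<Otimes>\<^sub>M M) h"
  proof (rule integrableI_bounded_set[where A = "{0..T} \<times> space M" and B = 1])
    show "emeasure (lborel \<Otimes>\<^sub>M M) ({0..T} \<times> space M) < \<infinity>"
      using T by (subst emeasure_pair_measure_Times) (auto simp: emeasure_space_1)
    show "h \<in> borel_measurable (lborel \<Otimes>\<^sub>M M)" unfolding h_def by measurable
  qed (auto simp: h_def space_pair_measure indicator_def intro!: AE_I2)
  have fst: "(\<integral>x. h (t, x) \<partial>M) = prob {x \<in> space M. X x < t} * indicator {0..T} t" for t
  proof -
    have "(\<integral>x. h (t, x) \<partial>M) = (\<integral>x. indicator {x \<in> space M. X x < t} x * indicator {0..T} t \<partial>M)"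
      unfolding h_def by (intro Bochner_Integration.integral_cong) (auto simp: indicator_def)
    then show ?thesis by simp
  qed
  have snd: "(\<integral>t. h (t, x) \<partial>lborel) = max 0 (T - X x)" if "x \<in> space M" for x
  proof -
    have "(\<integral>t. h (t, x) \<partial>lborel) = (\<integral>t. indicator {X x<..T} t \<partial>lborel)"
      unfolding h_def using nonneg[OF that]
      by (intro Bochner_Integration.integral_cong) (auto simp: indicator_def)
    also have "\<dots> = max 0 (T - X x)"
      by (cases "X x \<le> T") auto
    finally show ?thesis .
  qed
  show "integrable lborel (\<lambda>t. prob {x \<in> space M. X x < t} * indicator {0..T} t)"
    using P.integrable_fst'[OF h] by (simp add: fst)
  have int: "integrable M (\<lambda>x. max 0 (T - X x))" using X by auto
  have "T - expectation X = expectation (\<lambda>x. T - X x)" using X by (simp add: prob_space)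
  also have "\<dots> \<le> expectation (\<lambda>x. max 0 (T - X x))"
    using X int by (intro integral_mono) auto
  also have "\<dots> = expectation (\<lambda>x. \<integral>t. h (t, x) \<partial>lborel)"
    by (intro Bochner_Integration.integral_cong) (auto simp: snd)
  also have "\<dots> = (\<integral>t. expectation (\<lambda>x. h (t, x)) \<partial>lborel)"
    using P.Fubini_integral[of "\<lambda>t x. h (t, x)"] h by simp
  finally show "T - expectation X \<le> (\<integral>t. prob {x \<in> space M. X x < t} * indicator {0..T} t \<partial>lborel)"
    by (simp add: fst)
qed

text \<open>
  The weight \<open>1 / ((2 + w) * (v - t))\<close> on \<open>[0, v * (1 + w)]\<close> has total mass \<open>1\<close>, because
  \<open>ln (- w) = - (2 + w)\<close>.
\<close>

lemma (in prob_space) utility_ge_of_bid_utilities: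
  fixes X :: "'b \<Rightarrow> 'a \<Rightarrow> real"
  assumes w: "- 1 < w" "w < 0" "w * exp w = - exp (- 2 :: real)"
    and J: "\<And>j. j \<in> J \<Longrightarrow> 0 \<le> \<beta> j" "\<And>j. j \<in> J \<Longrightarrow> integrable M (X j)"
      "\<And>j x. j \<in> J \<Longrightarrow> x \<in> space M \<Longrightarrow> 0 \<le> X j x"
    and v: "0 \<le> v"
    and U: "\<And>t. 0 \<le> t \<Longrightarrow> t \<le> v \<Longrightarrow>
        (v - t) * (\<Sum>j\<in>J. \<beta> j * prob {x \<in> space M. X j x < t}) \<le> U"
  shows "(1 + w) / (2 + w) * (v * (\<Sum>j\<in>J. \<beta> j)) - 1 / (2 + w) * (\<Sum>j\<in>J. \<beta> j * expectation (X j)) \<le> U"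
\<comment> \<open>For \<open>v = 0\<close> the logarithmic weight degenerates, but then the target
  term vanishes and \<open>U\<close> is nonnegative.\<close>
proof (cases "v = 0")
  case True
  have "0 \<le> U" using U[of 0] True by simp
  moreover have "0 \<le> 1 / (2 + w) * (\<Sum>j\<in>J. \<beta> j * expectation (X j))"
    using w J by (intro mult_nonneg_nonneg sum_nonneg integral_nonneg) auto
  ultimately show ?thesis using True by simp
next
  case False
  then have v: "0 < v" using v by simp
  define T where "T = v * (1 + w)"
  have T: "0 \<le> T" using v w by (simp add: T_def)
  have "T < v" using v w by (simp add: T_def mult_pos_neg distrib_left)
  have vT: "v - T = - w * v" by (simp add: T_def algebra_simps)
  have "exp (- (2 + w)) = - w"
    using w(3) by (simp add: exp_add exp_minus field_simps exp_diff)
  then have lnw: "ln (- w) = - (2 + w)" by (metis ln_exp)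
  \<comment> \<open>\<open>F\<close> is an antiderivative of \<open>U\<close> times the weight, so
    total mass one amounts to \<open>F T - F 0 = U\<close>.\<close>
  define F where "F = (\<lambda>t. - U / (2 + w) * ln (v - t))"
  have FTC: "has_bochner_integral lborel (\<lambda>t. U / ((2 + w) * (v - t)) * indicator {0..T} t) (F T - F 0)"
  proof (rule has_bochner_integral_FTC_Icc_real)
    fix t assume "0 \<le> t" "t \<le> T"
    then have "t < v" using \<open>T < v\<close> by simp
    then show "(F has_real_derivative U / ((2 + w) * (v - t))) (at t)"
      unfolding F_def using w by (auto intro!: derivative_eq_intros)
    show "isCont (\<lambda>t. U / ((2 + w) * (v - t))) t"
      using \<open>t < v\<close> w by (intro continuous_intros) auto
  qed fact
  have "ln (v - T) = ln v - (2 + w)"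
    using v w ln_mult[of "- w" v] by (simp add: vT lnw)
  moreover have "F T - F 0 = U / (2 + w) * (ln v - ln (v - T))"
    by (simp add: F_def right_diff_distrib)
  ultimately have "F T - F 0 = U" using w by simp
  let ?P = "\<lambda>j t. prob {x \<in> space M. X j x < t} * indicator {0..T} t"
  have P: "integrable lborel (?P j)" "T - expectation (X j) \<le> (\<integral>t. ?P j t \<partial>lborel)" if "j \<in> J" for j
    using integral_prob_less_ge[of "X j" T] J T that by auto
  have "1 / (2 + w) * (\<Sum>j\<in>J. \<beta> j * (T - expectation (X j)))
      \<le> 1 / (2 + w) * (\<Sum>j\<in>J. \<beta> j * (\<integral>t. ?P j t \<partial>lborel))"
    using w J P by (intro mult_left_mono sum_mono) auto
  also have "\<dots> = (\<integral>t. 1 / (2 + w) * (\<Sum>j\<in>J. \<beta> j * ?P j t) \<partial>lborel)"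
    using P by (simp add: Bochner_Integration.integral_sum)
  also have "\<dots> \<le> (\<integral>t. U / ((2 + w) * (v - t)) * indicator {0..T} t \<partial>lborel)"
  proof (rule integral_mono)
    show "integrable lborel (\<lambda>t. 1 / (2 + w) * (\<Sum>j\<in>J. \<beta> j * ?P j t))"
      using P by (intro integrable_mult_right Bochner_Integration.integrable_sum) auto
    show "integrable lborel (\<lambda>t. U / ((2 + w) * (v - t)) * indicator {0..T} t)"
      using FTC by (auto simp: has_bochner_integral_iff)
    fix t
    show "1 / (2 + w) * (\<Sum>j\<in>J. \<beta> j * ?P j t) \<le> U / ((2 + w) * (v - t)) * indicator {0..T} t"
    proof (cases "t \<in> {0..T}")
      case True
      then have "(\<Sum>j\<in>J. \<beta> j * prob {x \<in> space M. X j x < t}) \<le> U / (v - t)"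
        using U[of t] \<open>T < v\<close> by (simp add: pos_le_divide_eq mult.commute)
      then have "1 / (2 + w) * (\<Sum>j\<in>J. \<beta> j * prob {x \<in> space M. X j x < t}) \<le> 1 / (2 + w) * (U / (v - t))"
        using w by (intro mult_left_mono) auto
      then show ?thesis using True by simp
    qed simp
  qed
  also have "\<dots> = U"
    using FTC \<open>F T - F 0 = U\<close> by (auto simp: has_bochner_integral_iff)
  finally have "1 / (2 + w) * (\<Sum>j\<in>J. \<beta> j * (T - expectation (X j))) \<le> U" .
  moreover have "(\<Sum>j\<in>J. \<beta> j * (T - expectation (X j))) =
      (1 + w) * (v * (\<Sum>j\<in>J. \<beta> j)) - (\<Sum>j\<in>J. \<beta> j * expectation (X j))"
    by (simp add: T_def algebra_simps sum_subtractf sum.distrib sum_distrib_left)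
  ultimately show ?thesis by (simp add: diff_divide_distrib)
qed

section \<open>Extended expectations\<close>

lemma expect_distr:
  assumes "g \<in> M \<rightarrow>\<^sub>M N" "f \<in> borel_measurable N"
  shows "expect (distr M N g) f = expect M (\<lambda>x. f (g x))"
  using assms by (simp add: expect_def nn_integral_distr)

lemma expect_cong:
  assumes "\<And>x. x \<in> space M \<Longrightarrow> f x = g x"
  shows "expect M f = expect M g"
  using assms by (simp add: expect_def cong: nn_integral_cong)

text \<open>The bound \<open>C\<close> makes the positive part finite, so an infinite negative part
  would give \<open>expect M f\<close> the value minus infinity.\<close>

lemma integrable_of_expect_nonneg:
  fixes f :: "'a \<Rightarrow> real"
  assumes "prob_space M" "f \<in> borel_measurable M" "\<And>x. x \<in> space M \<Longrightarrow> f x \<le> C" "0 \<le> expect M f"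
  shows "integrable M f"
proof -
  interpret prob_space M by fact
  have "(\<integral>\<^sup>+x. ennreal (f x) \<partial>M) \<le> (\<integral>\<^sup>+x. ennreal C \<partial>M)"
    using assms(3) by (intro nn_integral_mono) (auto intro: ennreal_leI)
  then have pos: "(\<integral>\<^sup>+x. ennreal (f x) \<partial>M) < \<infinity>"
    by (auto simp: emeasure_space_1 less_top[symmetric] top_unique)
  moreover have "(\<integral>\<^sup>+x. ennreal (- f x) \<partial>M) < \<infinity>"
  proof (rule ccontr)
    assume "\<not> ?thesis"
    then have "(\<integral>\<^sup>+x. ennreal (- f x) \<partial>M) = \<infinity>" by (simp add: less_top[symmetric])
    moreover obtain r where "(\<integral>\<^sup>+x. ennreal (f x) \<partial>M) = ennreal r" "0 \<le> r"
      using pos by (cases "\<integral>\<^sup>+x. ennreal (f x) \<partial>M") auto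
    ultimately have "expect M f = - \<infinity>" by (simp add: expect_def enn2ereal_ennreal)
    with assms(4) show False by simp
  qed
  ultimately show ?thesis
    using assms(2) by (auto simp: real_integrable_def)
qed

section \<open>Ranks and unilateral deviations\<close>

lemma space_bid_space: "space bid_space = {0..}"
  by (simp add: bid_space_def space_restrict_space)

text \<open>Bidding \<open>t\<close> with probability \<open>q\<close> and \<open>0\<close> otherwise scales the expected payment down by \<open>q\<close>.\<close>

definition two_point_bid :: "real \<Rightarrow> real \<Rightarrow> real measure" where
  "two_point_bid q t = distr (measure_pmf (bernoulli_pmf q)) bid_space (\<lambda>c. if c then t else 0)"

lemma two_point_bid_in_prob_algebra:
  assumes "0 \<le> t"
  shows "two_point_bid q t \<in> space (prob_algebra bid_space)"
  using assms unfolding two_point_bid_def space_prob_algebra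
  by (auto intro!: prob_space.prob_space_distr prob_space_measure_pmf simp: space_bid_space)

section \<open>Measurability and bounds for the auction primitives\<close>

locale gfp =
  fixes I :: gfp_auction and A :: "(nat \<Rightarrow> real) measure"
  assumes inst: "gfp_instance I"
    and A_in: "A \<in> space (prob_algebra (profile_space I))"
begin

abbreviation "N \<equiv> {1..bidders I}"

sublocale prob_space A
  using A_in by (simp add: space_prob_algebra)

lemma sets_A [measurable_cong]: "sets A = sets (profile_space I)"
  using A_in by (simp add: space_prob_algebra)

lemma space_A: "space A = space (profile_space I)"
  by (rule sets_eq_imp_space_eq[OF sets_A])

lemma space_profile: "space (profile_space I) = N \<rightarrow>\<^sub>E {0..}"
  by (simp add: profile_space_def space_PiM space_bid_space)

lemma ctr_nonneg: "j \<in> {0..slots I} \<Longrightarrow> 0 \<le> ctr I j"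
  using inst unfolding gfp_instance_def by (cases "j = 0") (auto intro: less_imp_le)

lemma ctr_pos: "j \<in> {1..slots I} \<Longrightarrow> 0 < ctr I j"
  using inst unfolding gfp_instance_def by auto

lemma ctr_antimono: "\<lbrakk>1 \<le> j; j \<le> k; k \<le> slots I\<rbrakk> \<Longrightarrow> ctr I k \<le> ctr I j"
  using inst unfolding gfp_instance_def by auto

lemma click_value_nonneg: "i \<in> N \<Longrightarrow> 0 \<le> click_value I i"
  using inst unfolding gfp_instance_def by auto

lemma budget_pos: "i \<in> N \<Longrightarrow> 0 < budget I i"
  using inst unfolding gfp_instance_def by auto

lemma rank_bij: "a \<in> space (profile_space I) \<Longrightarrow> bij_betw (rank_of I a) N N"
  using inst unfolding gfp_instance_def ranking_rule_def by auto

lemma rank_less: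
  "\<lbrakk>a \<in> space (profile_space I); i \<in> N; k \<in> N; a k < a i\<rbrakk> \<Longrightarrow> rank_of I a i < rank_of I a k"
  using inst unfolding gfp_instance_def ranking_rule_def by auto

lemma rank_measurable [measurable]:
  "i \<in> N \<Longrightarrow> (\<lambda>a. rank_of I a i) \<in> profile_space I \<rightarrow>\<^sub>M count_space UNIV"
  using inst unfolding gfp_instance_def ranking_rule_def by auto

lemma slot_measurable [measurable]:
  "i \<in> N \<Longrightarrow> slot_of I i \<in> profile_space I \<rightarrow>\<^sub>M count_space UNIV"
  unfolding slot_of_def by measurable

lemma bid_measurable [measurable]: "i \<in> N \<Longrightarrow> (\<lambda>a. a i) \<in> borel_measurable (profile_space I)"
proof -
  assume i: "i \<in> N"
  have "(\<lambda>a. a i) \<in> profile_space I \<rightarrow>\<^sub>M bid_space"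
    unfolding profile_space_def by (rule measurable_component_singleton[OF i])
  moreover have "id \<in> borel_measurable bid_space"
    unfolding bid_space_def by (simp add: measurable_restrict_space1)
  ultimately show ?thesis by (auto dest: measurable_compose[where g = id])
qed

lemma ctr_slot_measurable [measurable]:
  "i \<in> N \<Longrightarrow> (\<lambda>a. ctr I (slot_of I i a)) \<in> borel_measurable (profile_space I)"
  by (rule measurable_compose[OF slot_measurable]) auto

lemma payment_measurable [measurable]:
  "i \<in> N \<Longrightarrow> payment I i \<in> borel_measurable (profile_space I)"
  unfolding payment_def[abs_def] by measurable

lemma utility_measurable [measurable]:
  "i \<in> N \<Longrightarrow> utility I i \<in> borel_measurable (profile_space I)"
  unfolding utility_def[abs_def] valuation_def by measurable

lemma slot_le: "slot_of I i a \<in> {0..slots I}"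
  by (auto simp: slot_of_def)

lemma ctr_slot_nonneg: "0 \<le> ctr I (slot_of I i a)"
  using ctr_nonneg slot_le by blast

text \<open>The sum is a uniform bound on the rates that remains valid for
  \<open>slots I = 0\<close>, where \<open>ctr I 1\<close> is unconstrained.\<close>

lemma ctr_le_sum: "j \<in> {0..slots I} \<Longrightarrow> ctr I j \<le> (\<Sum>j\<in>{0..slots I}. ctr I j)"
  by (rule member_le_sum) (auto intro: ctr_nonneg)

lemma ctr_slot_le: "ctr I (slot_of I i a) \<le> (\<Sum>j\<in>{0..slots I}. ctr I j)"
  using ctr_le_sum slot_le by blast

lemma bid_nonneg: "\<lbrakk>a \<in> space (profile_space I); i \<in> N\<rbrakk> \<Longrightarrow> 0 \<le> a i"
  by (auto simp: space_profile)

lemma payment_nonneg: "\<lbrakk>a \<in> space (profile_space I); i \<in> N\<rbrakk> \<Longrightarrow> 0 \<le> payment I i a"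
  unfolding payment_def by (intro mult_nonneg_nonneg ctr_slot_nonneg bid_nonneg)

lemma integrable_ctr_slot:
  assumes "i \<in> N" "g \<in> A \<rightarrow>\<^sub>M profile_space I"
  shows "integrable A (\<lambda>a. ctr I (slot_of I i (g a)))"
proof (rule integrable_const_bound)
  show "(\<lambda>a. ctr I (slot_of I i (g a))) \<in> borel_measurable A"
    by (rule measurable_compose[OF assms(2) ctr_slot_measurable[OF assms(1)]])
qed (use ctr_slot_le ctr_slot_nonneg in auto)

section \<open>Replacing one bid in a profile\<close>

lemma update_in_space:
  "\<lbrakk>a \<in> space (profile_space I); i \<in> N; 0 \<le> t\<rbrakk> \<Longrightarrow> a(i := t) \<in> space (profile_space I)"
  by (auto simp: space_profile PiE_def extensional_def)

text \<open>The coordinate that \<open>others_marginal\<close> forgets is overwritten by the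
  deviation anyway, so deviations can be evaluated on \<open>A\<close> itself.\<close>

lemma restrict_update:
  assumes "a \<in> space (profile_space I)" "i \<in> N"
  shows "(restrict a (N - {i}))(i := t) = a(i := t)"
  using assms by (auto simp: space_profile PiE_def extensional_def restrict_def fun_eq_iff)

lemma update_measurable:
  assumes i: "i \<in> N" and g: "g \<in> M \<rightarrow>\<^sub>M bid_space" and h: "h \<in> M \<rightarrow>\<^sub>M others_space I i"
  shows "(\<lambda>x. (h x)(i := g x)) \<in> M \<rightarrow>\<^sub>M profile_space I"
  unfolding profile_space_def
  by (rule measurable_fun_upd[of _ "N - {i}"])
     (use i g h in \<open>auto simp: others_space_def insert_absorb\<close>)

lemma restrict_measurable:
  "(\<lambda>a. restrict a (N - {i})) \<in> profile_space I \<rightarrow>\<^sub>M others_space I i"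
  unfolding profile_space_def others_space_def by (rule measurable_restrict_subset) auto

lemma update_const_measurable [measurable]:
  assumes i: "i \<in> N" and t: "0 \<le> t"
  shows "(\<lambda>a. a(i := t)) \<in> profile_space I \<rightarrow>\<^sub>M profile_space I"
proof -
  have "(\<lambda>a. (restrict a (N - {i}))(i := t)) \<in> profile_space I \<rightarrow>\<^sub>M profile_space I"
    using i t by (intro update_measurable restrict_measurable) (auto simp: space_bid_space)
  then show ?thesis
    by (rule measurable_cong[THEN iffD1, rotated]) (use restrict_update i in auto)
qed

text \<open>The product of \<open>two_point_bid\<close> with the others' marginal is an image of the
  product of a coin with \<open>A\<close>, and Fubini splits along the coin. Boundedness of
  \<open>f\<close> at both bids turns the extended expectation into an ordinary integral.\<close>

lemma deviation_expect_two_point_bid: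
  assumes i: "i \<in> N" and t: "0 \<le> t" and q: "0 \<le> q" "q \<le> 1"
    and f [measurable]: "f \<in> borel_measurable (profile_space I)"
    and bound: "\<And>a. a \<in> space (profile_space I) \<Longrightarrow> \<bar>f (a(i := t))\<bar> \<le> C"
      "\<And>a. a \<in> space (profile_space I) \<Longrightarrow> \<bar>f (a(i := 0))\<bar> \<le> C"
  shows "deviation_expect I i (two_point_bid q t) A f =
    ereal (q * expectation (\<lambda>a. f (a(i := t))) + (1 - q) * expectation (\<lambda>a. f (a(i := 0))))"
proof -
  let ?B = "measure_pmf (bernoulli_pmf q)"
  let ?bid = "\<lambda>c. if c then t else 0"
  let ?h = "\<lambda>(c, a). f (a(i := ?bid c))"
  have res: "(\<lambda>a. restrict a (N - {i})) \<in> A \<rightarrow>\<^sub>M others_space I i"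
    using restrict_measurable by (simp cong: measurable_cong_sets add: sets_A)
  have bid: "?bid \<in> ?B \<rightarrow>\<^sub>M bid_space"
    using t by (auto simp: space_bid_space)
  interpret D: prob_space "distr A (others_space I i) (\<lambda>a. restrict a (N - {i}))"
    by (rule prob_space_distr[OF res])
  interpret B: pair_prob_space ?B A ..
  have prod: "two_point_bid q t \<Otimes>\<^sub>M others_marginal I i A =
      distr (?B \<Otimes>\<^sub>M A) (bid_space \<Otimes>\<^sub>M others_space I i) (\<lambda>(c, a). (?bid c, restrict a (N - {i})))"
    unfolding two_point_bid_def others_marginal_def
    by (rule pair_measure_distr[OF bid res]) unfold_locales
  have meas: "(\<lambda>(b, a). f (a(i := b))) \<in> borel_measurable (bid_space \<Otimes>\<^sub>M others_space I i)"
    unfolding split_beta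
    by (intro measurable_compose[OF _ f] update_measurable[OF i]) auto
  have map: "(\<lambda>(c, a). (?bid c, restrict a (N - {i}))) \<in> ?B \<Otimes>\<^sub>M A \<rightarrow>\<^sub>M bid_space \<Otimes>\<^sub>M others_space I i"
    unfolding split_beta
    by (intro measurable_Pair measurable_compose[OF measurable_fst bid] measurable_compose[OF measurable_snd res])
  have int: "integrable (?B \<Otimes>\<^sub>M A) ?h"
  proof (rule B.integrable_const_bound[where B = C])
    \<comment> \<open>With the case distinction pulled out of \<open>f\<close>, each branch
      overwrites with a constant bid, which is known to be measurable.\<close>
    have "(\<lambda>x. if fst x then f ((snd x)(i := t)) else f ((snd x)(i := 0)))
        \<in> borel_measurable (?B \<Otimes>\<^sub>M A)"
      using i t by measurable
    then show "?h \<in> borel_measurable (?B \<Otimes>\<^sub>M A)"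
      by (rule measurable_cong[THEN iffD1, rotated]) auto
    show "AE x in ?B \<Otimes>\<^sub>M A. norm (?h x) \<le> C"
      using bound by (intro AE_I2) (auto simp: space_pair_measure space_A)
  qed
  have "deviation_expect I i (two_point_bid q t) A f =
      expect (?B \<Otimes>\<^sub>M A) (\<lambda>(c, a). f ((restrict a (N - {i}))(i := ?bid c)))"
    unfolding deviation_expect_def prod
    by (subst expect_distr[OF map meas]) (simp only: split_def fst_conv snd_conv)
  also have "\<dots> = expect (?B \<Otimes>\<^sub>M A) ?h"
    by (rule expect_cong) (simp only: space_pair_measure space_A mem_Times_iff split_beta restrict_update[OF _ i])
  also have "\<dots> = ereal (\<integral>x. ?h x \<partial>(?B \<Otimes>\<^sub>M A))"
    by (rule expect_eq_integral[OF int])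
  also have "(\<integral>x. ?h x \<partial>(?B \<Otimes>\<^sub>M A)) = (\<integral>c. (\<integral>a. f (a(i := ?bid c)) \<partial>A) \<partial>?B)"
    using B.integral_fst'[OF int] by simp
  also have "\<dots> = q * expectation (\<lambda>a. f (a(i := t))) + (1 - q) * expectation (\<lambda>a. f (a(i := 0)))"
    using q by (simp add: mult.commute)
  finally show ?thesis .
qed

text \<open>Ranks form a bijection, so for \<open>j\<close> in \<open>N\<close> one term survives
  and this is the \<open>j\<close>-th highest bid. The sum inherits measurability from
  \<open>rank_of\<close> without inverting the ranking.\<close>

definition position_bid :: "nat \<Rightarrow> (nat \<Rightarrow> real) \<Rightarrow> real" where
  "position_bid j a = (\<Sum>i\<in>N. a i * of_bool (rank_of I a i = j))"

lemma position_bid_eq: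
  assumes "a \<in> space (profile_space I)" "i \<in> N"
  shows "position_bid (rank_of I a i) a = a i"
proof -
  have "position_bid (rank_of I a i) a = (\<Sum>k\<in>N. if k = i then a k else 0)"
    unfolding position_bid_def using bij_betw_imp_inj_on[OF rank_bij[OF assms(1)]] assms(2)
    by (intro sum.cong) (auto dest: inj_onD)
  then show ?thesis using assms(2) by simp
qed

lemma position_bid_measurable [measurable]:
  "position_bid j \<in> borel_measurable (profile_space I)"
  unfolding position_bid_def[abs_def] of_bool_def by measurable

lemma position_bid_nonneg: "a \<in> space (profile_space I) \<Longrightarrow> 0 \<le> position_bid j a"
  unfolding position_bid_def by (intro sum_nonneg mult_nonneg_nonneg) (auto intro: bid_nonneg)

text \<open>Whoever is ahead of \<open>i\<close> after the deviation bids at least \<open>t\<close>,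
  hence more than the bid at position \<open>j\<close>, and so stood strictly ahead of
  \<open>j\<close> before. At most \<open>j - 1\<close> bidders did.\<close>

lemma rank_update_le:
  assumes a: "a \<in> space (profile_space I)" and i: "i \<in> N" and j: "j \<in> N"
    and t: "position_bid j a < t"
  shows "rank_of I (a(i := t)) i \<le> j"
proof -
  let ?a = "a(i := t)"
  let ?S = "{k \<in> N. rank_of I ?a k < rank_of I ?a i}"
  have a': "?a \<in> space (profile_space I)"
    using update_in_space[OF a i] position_bid_nonneg[OF a, of j] t by simp
  note bij = rank_bij[OF a] and bij' = rank_bij[OF a']
  obtain l where l: "l \<in> N" "rank_of I a l = j"
    using bij_betw_imp_surj_on[OF bij] j by (metis imageE)
  have al: "a l < t" using position_bid_eq[OF a l(1)] l(2) t by simp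
  have "{1..<rank_of I ?a i} \<subseteq> rank_of I ?a ` ?S"
  proof
    fix r assume r: "r \<in> {1..<rank_of I ?a i}"
    then have "r \<in> N" using bij_betwE[OF bij'] i by fastforce
    then obtain k where "k \<in> N" "r = rank_of I ?a k"
      using bij_betw_imp_surj_on[OF bij'] by (metis imageE)
    then show "r \<in> rank_of I ?a ` ?S" using r by auto
  qed
  then have "rank_of I ?a i - 1 \<le> card ?S"
    using surj_card_le[of ?S "{1..<rank_of I ?a i}" "rank_of I ?a"] by simp
  also have "card ?S = card (rank_of I a ` ?S)"
    by (rule card_image[symmetric]) (rule inj_on_subset[OF bij_betw_imp_inj_on[OF bij]], auto)
  also have "\<dots> \<le> card {1..<j}"
  proof (rule card_mono)
    show "rank_of I a ` ?S \<subseteq> {1..<j}"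
    proof safe
      fix k assume k: "k \<in> N" "rank_of I ?a k < rank_of I ?a i"
      have "\<not> ?a k < ?a i" using rank_less[OF a' i k(1)] k(2) by auto
      then have "a l < a k" using k(2) al by (auto split: if_splits)
      then have "rank_of I a k < j" using rank_less[OF a k(1) l(1)] l(2) by simp
      moreover have "rank_of I a k \<in> N" using bij_betwE[OF bij] k(1) by blast
      ultimately show "rank_of I a k \<in> {1..<j}" by simp
    qed
  qed simp
  finally have "rank_of I ?a i - 1 \<le> j - 1" by simp
  \<comment> \<open>Subtraction on naturals truncates; \<open>1 \<le> j\<close> is what allows
    cancelling it.\<close>
  moreover have "1 \<le> j" using j by simp
  ultimately show ?thesis by linarith
qed

lemma slots_le: "slots I \<le> bidders I"
  using inst unfolding gfp_instance_def by simp

text \<open>A rank of at most \<open>j\<close> lies within the slots, so \<open>slot_of\<close> does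
  not fall back to \<open>0\<close> and the monotonicity of the rates applies.\<close>

lemma ctr_slot_update_ge:
  assumes a: "a \<in> space (profile_space I)" and i: "i \<in> N" and j: "j \<in> {1..slots I}"
    and t: "position_bid j a < t"
  shows "ctr I j \<le> ctr I (slot_of I i (a(i := t)))"
proof -
  have "a(i := t) \<in> space (profile_space I)"
    using update_in_space[OF a i] position_bid_nonneg[OF a, of j] t by simp
  then have "rank_of I (a(i := t)) i \<in> N" using bij_betwE[OF rank_bij] i by blast
  moreover have "rank_of I (a(i := t)) i \<le> j"
    using rank_update_le[OF a i _ t] j slots_le by auto
  ultimately show ?thesis using j by (auto simp: slot_of_def intro: ctr_antimono)
qed

text \<open>Revenue is regrouped by slot; bidders without a slot pay nothing because
  \<open>ctr I 0 = 0\<close>.\<close>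

lemma sum_payment:
  assumes a: "a \<in> space (profile_space I)"
  shows "(\<Sum>i\<in>N. payment I i a) = (\<Sum>j\<in>{1..slots I}. ctr I j * position_bid j a)"
proof -
  have "(\<Sum>j\<in>{1..slots I}. ctr I j * position_bid j a) =
      (\<Sum>i\<in>N. \<Sum>j\<in>{1..slots I}. ctr I j * (a i * of_bool (rank_of I a i = j)))"
    unfolding position_bid_def sum_distrib_left by (rule sum.swap)
  also have "\<dots> = (\<Sum>i\<in>N. payment I i a)"
  proof (rule sum.cong[OF refl])
    fix i assume i: "i \<in> N"
    have "rank_of I a i \<in> N" using bij_betwE[OF rank_bij[OF a]] i by blast
    then have "payment I i a = (\<Sum>j\<in>{1..slots I}. if rank_of I a i = j then ctr I j * a i else 0)"
      using inst by (auto simp: payment_def slot_of_def gfp_instance_def)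
    also have "\<dots> = (\<Sum>j\<in>{1..slots I}. ctr I j * (a i * of_bool (rank_of I a i = j)))"
      by (intro sum.cong) auto
    finally show "(\<Sum>j\<in>{1..slots I}. ctr I j * (a i * of_bool (rank_of I a i = j))) = payment I i a"
      by simp
  qed
  finally show ?thesis by simp
qed

section \<open>Clicks won and money spent by a deviation\<close>

abbreviation clicks_at :: "nat \<Rightarrow> real \<Rightarrow> real" where
  "clicks_at i t \<equiv> expectation (\<lambda>a. ctr I (slot_of I i (a(i := t))))"

lemma integrable_clicks_at:
  "\<lbrakk>i \<in> N; 0 \<le> t\<rbrakk> \<Longrightarrow> integrable A (\<lambda>a. ctr I (slot_of I i (a(i := t))))"
  by (rule integrable_ctr_slot) (auto intro: update_const_measurable simp: sets_A cong: measurable_cong_sets)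

lemma clicks_at_nonneg: "0 \<le> clicks_at i t"
  by (simp add: ctr_slot_nonneg)

text \<open>On the event that the \<open>j\<close>-th bid is below \<open>t\<close>, the deviation
  wins a slot at least as good as \<open>j\<close>; off it, the rate won is still
  nonnegative.\<close>

lemma ctr_prob_le_clicks_at:
  assumes i: "i \<in> N" and j: "j \<in> {1..slots I}" and t: "0 \<le> t"
  shows "ctr I j * prob {a \<in> space A. position_bid j a < t} \<le> clicks_at i t"
proof -
  have "ctr I j * prob {a \<in> space A. position_bid j a < t} =
      expectation (\<lambda>a. ctr I j * indicator {a \<in> space A. position_bid j a < t} a)"
    by simp
  also have "\<dots> \<le> clicks_at i t"
  proof (rule integral_mono)
    show "integrable A (\<lambda>a. ctr I j * indicator {a \<in> space A. position_bid j a < t} a)"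
      by (intro integrable_mult_right integrable_real_indicator) (auto simp: less_top[symmetric])
    fix a assume "a \<in> space A"
    then show "ctr I j * indicator {a \<in> space A. position_bid j a < t} a \<le> ctr I (slot_of I i (a(i := t)))"
      using ctr_slot_update_ge[OF _ i j] ctr_slot_nonneg by (auto simp: indicator_def space_A)
  qed (rule integrable_clicks_at[OF i t])
  finally show ?thesis .
qed

text \<open>A bid of \<open>0\<close> pays nothing, so only the branch bidding \<open>t\<close>
  contributes.\<close>

lemma deviation_expect_payment:
  assumes i: "i \<in> N" and t: "0 \<le> t" and q: "0 \<le> q" "q \<le> 1"
  shows "deviation_expect I i (two_point_bid q t) A (payment I i) = ereal (q * t * clicks_at i t)"
proof -
  let ?C = "t * (\<Sum>j\<in>{0..slots I}. ctr I j)"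
  have "deviation_expect I i (two_point_bid q t) A (payment I i) =
    ereal (q * expectation (\<lambda>a. payment I i (a(i := t))) + (1 - q) * expectation (\<lambda>a. payment I i (a(i := 0))))"
    by (rule deviation_expect_two_point_bid[OF i t q payment_measurable[OF i], of ?C])
       (use t ctr_slot_le ctr_slot_nonneg ctr_nonneg in
         \<open>auto simp: payment_def abs_mult mult.commute intro!: mult_left_mono mult_nonneg_nonneg sum_nonneg\<close>)
  then show ?thesis by (simp add: payment_def mult_ac)
qed

lemma deviation_expect_utility:
  assumes i: "i \<in> N" and t: "0 \<le> t" and q: "0 \<le> q" "q \<le> 1"
  shows "deviation_expect I i (two_point_bid q t) A (utility I i) =
    ereal (q * (click_value I i - t) * clicks_at i t + (1 - q) * click_value I i * clicks_at i 0)"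
proof -
  let ?C = "(click_value I i + t) * (\<Sum>j\<in>{0..slots I}. ctr I j)"
  have u: "utility I i (a(i := s)) = (click_value I i - s) * ctr I (slot_of I i (a(i := s)))" for a s
    by (simp add: utility_def valuation_def payment_def algebra_simps)
  have "\<bar>utility I i (a(i := s))\<bar> \<le> ?C" if "0 \<le> s" "s \<le> t" for a s
    unfolding u abs_mult using that click_value_nonneg[OF i] ctr_slot_nonneg ctr_slot_le
    by (intro mult_mono) auto
  then have "deviation_expect I i (two_point_bid q t) A (utility I i) =
    ereal (q * expectation (\<lambda>a. utility I i (a(i := t))) + (1 - q) * expectation (\<lambda>a. utility I i (a(i := 0))))"
    using t by (intro deviation_expect_two_point_bid[OF i t q utility_measurable[OF i], of ?C]) auto
  then show ?thesis by (simp add: u mult_ac)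
qed

end

section \<open>Equilibrium bounds\<close>

locale gfp_equilibrium = gfp +
  assumes eq: "coarse_correlated_eq I A"
begin

lemma expect_utility_ge:
  assumes i: "i \<in> N" and t: "0 \<le> t" and q: "0 \<le> q" "q \<le> 1"
    and feasible: "ereal (q * t * clicks_at i t) \<le> budget I i"
  shows "ereal (q * (click_value I i - t) * clicks_at i t) \<le> expect A (utility I i)"
proof -
  have "two_point_bid q t \<in> budget_feasible_deviations I i A"
    using feasible two_point_bid_in_prob_algebra[OF t] deviation_expect_payment[OF i t q]
    by (simp add: budget_feasible_deviations_def)
  then have "deviation_expect I i (two_point_bid q t) A (utility I i) \<le> expect A (utility I i)"
    using eq i unfolding coarse_correlated_eq_def by blast
  moreover have "0 \<le> (1 - q) * click_value I i * clicks_at i 0"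
    using q click_value_nonneg[OF i] clicks_at_nonneg by simp
  ultimately show ?thesis
    unfolding deviation_expect_utility[OF i t q] by (elim order_trans[rotated]) simp
qed

text \<open>Always bidding \<open>0\<close> is affordable. This excludes an expected utility of
  minus infinity, from which all integrability in equilibrium follows.\<close>

lemma expect_utility_nonneg: "i \<in> N \<Longrightarrow> 0 \<le> expect A (utility I i)"
  using expect_utility_ge[of i 0 0] budget_pos[of i] by (simp add: less_imp_le zero_ereal_def)

section \<open>Integrability and revenue in equilibrium\<close>

lemma measurable_A: "f \<in> borel_measurable (profile_space I) \<Longrightarrow> f \<in> borel_measurable A"
  by (simp cong: measurable_cong_sets add: sets_A)

lemma integrable_utility: assumes i: "i \<in> N" shows "integrable A (utility I i)"
proof (rule integrable_of_expect_nonneg[OF prob_space_axioms measurable_A[OF utility_measurable[OF i]]])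
  fix a assume "a \<in> space A"
  then have "utility I i a \<le> click_value I i * ctr I (slot_of I i a)"
    using payment_nonneg[OF _ i] by (simp add: utility_def valuation_def space_A)
  also have "\<dots> \<le> click_value I i * (\<Sum>j\<in>{0..slots I}. ctr I j)"
    by (intro mult_left_mono ctr_slot_le click_value_nonneg i)
  finally show "utility I i a \<le> click_value I i * (\<Sum>j\<in>{0..slots I}. ctr I j)" .
qed (rule expect_utility_nonneg[OF i])

lemma integrable_valuation:
  "i \<in> N \<Longrightarrow> integrable A (\<lambda>a. valuation I i (slot_of I i a))"
  unfolding valuation_def
  by (intro integrable_mult_right integrable_ctr_slot) (auto simp: sets_A cong: measurable_cong_sets)

lemma payment_eq: "payment I i a = valuation I i (slot_of I i a) - utility I i a"
  by (simp add: utility_def)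

text \<open>An infinite budget puts no limit on expected payments, so finiteness is derived from the
  utility instead.\<close>

lemma integrable_payment: "i \<in> N \<Longrightarrow> integrable A (payment I i)"
  unfolding payment_eq[abs_def] by (intro Bochner_Integration.integrable_diff integrable_valuation integrable_utility)

lemma expectation_payment:
  "i \<in> N \<Longrightarrow> expectation (payment I i) =
     expectation (\<lambda>a. valuation I i (slot_of I i a)) - expectation (utility I i)"
  unfolding payment_eq[abs_def] by (intro Bochner_Integration.integral_diff integrable_valuation integrable_utility)

lemma expectation_payment_nonneg: "i \<in> N \<Longrightarrow> 0 \<le> expectation (payment I i)"
  by (intro integral_nonneg_AE AE_I2) (simp add: payment_nonneg space_A)

lemma expectation_payment_le_budget: "i \<in> N \<Longrightarrow> ereal (expectation (payment I i)) \<le> budget I i"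
  using eq expect_eq_integral[OF integrable_payment] unfolding coarse_correlated_eq_def by metis

lemma expectation_utility_ge:
  assumes "i \<in> N" "0 \<le> t" "0 \<le> q" "q \<le> 1" "ereal (q * t * clicks_at i t) \<le> budget I i"
  shows "q * (click_value I i - t) * clicks_at i t \<le> expectation (utility I i)"
  using expect_utility_ge[OF assms] expect_eq_integral[OF integrable_utility[OF assms(1)]] by simp

text \<open>\<open>ctr I j * position_bid j a\<close> is one nonnegative summand of the total
  payment, and \<open>ctr I j\<close> is positive.\<close>

lemma integrable_position_bid:
  assumes j: "j \<in> {1..slots I}"
  shows "integrable A (position_bid j)"
proof (rule Bochner_Integration.integrable_bound)
  show "integrable A (\<lambda>a. (\<Sum>i\<in>N. payment I i a) / ctr I j)"
    by (intro integrable_divide Bochner_Integration.integrable_sum integrable_payment)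
  show "position_bid j \<in> borel_measurable A" by (rule measurable_A) measurable
  show "AE a in A. norm (position_bid j a) \<le> norm ((\<Sum>i\<in>N. payment I i a) / ctr I j)"
  proof (rule AE_I2)
    fix a assume "a \<in> space A"
    then have a: "a \<in> space (profile_space I)" by (simp add: space_A)
    have "ctr I j * position_bid j a \<le> (\<Sum>i\<in>N. payment I i a)"
      unfolding sum_payment[OF a] using j
      by (intro member_le_sum mult_nonneg_nonneg ctr_nonneg position_bid_nonneg a) auto
    then show "norm (position_bid j a) \<le> norm ((\<Sum>i\<in>N. payment I i a) / ctr I j)"
      using ctr_pos[OF j] position_bid_nonneg[OF a, of j] payment_nonneg[OF a]
      by (simp add: field_simps sum_nonneg)
  qed
qed

lemma sum_expectation_payment:
  "(\<Sum>i\<in>N. expectation (payment I i)) = (\<Sum>j\<in>{1..slots I}. ctr I j * expectation (position_bid j))"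
proof -
  have "(\<Sum>i\<in>N. expectation (payment I i)) = expectation (\<lambda>a. \<Sum>i\<in>N. payment I i a)"
    by (intro Bochner_Integration.integral_sum[symmetric] integrable_payment)
  also have "\<dots> = expectation (\<lambda>a. \<Sum>j\<in>{1..slots I}. ctr I j * position_bid j a)"
    by (intro Bochner_Integration.integral_cong refl sum_payment) (simp add: space_A)
  also have "\<dots> = (\<Sum>j\<in>{1..slots I}. ctr I j * expectation (position_bid j))"
    by (subst Bochner_Integration.integral_sum) (auto intro: integrable_position_bid)
  finally show ?thesis .
qed

text \<open>
  The target allocation \<open>z\<close> has at most value \<open>click_value I i * y \<le> budget I i\<close>. Bidding \<open>t\<close>
  with probability \<open>S / clicks_at i t\<close> wins \<open>S \<le> y\<close> expected clicks, hence is affordable for every \<open>t\<close>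
  up to the value per click.
\<close>

lemma utility_ge_scaled_bid:
  assumes i: "i \<in> N" and z: "\<And>j. j \<in> {1..slots I} \<Longrightarrow> 0 \<le> z j" "(\<Sum>j\<in>{1..slots I}. z j) \<le> 1"
    and budget: "ereal (click_value I i * (\<Sum>j\<in>{1..slots I}. z j * ctr I j)) \<le> budget I i"
    and t: "0 \<le> t" "t \<le> click_value I i"
  shows "(click_value I i - t) *
      (\<Sum>j\<in>{1..slots I}. z j * ctr I j * prob {a \<in> space A. position_bid j a < t})
    \<le> expectation (utility I i)"
proof -
  let ?J = "{1..slots I}" and ?v = "click_value I i" and ?G = "clicks_at i t"
  define S where "S = (\<Sum>j\<in>?J. z j * ctr I j * prob {a \<in> space A. position_bid j a < t})"
  have "S \<le> (\<Sum>j\<in>?J. z j * ?G)"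
    unfolding S_def mult.assoc by (intro sum_mono mult_left_mono ctr_prob_le_clicks_at i t z)
  also have "\<dots> \<le> ?G"
    using mult_right_mono[OF z(2) clicks_at_nonneg[of i t]] by (simp add: sum_distrib_right)
  finally have SG: "S \<le> ?G" .
  have "S \<le> (\<Sum>j\<in>?J. z j * ctr I j * 1)"
    unfolding S_def by (intro sum_mono mult_left_mono mult_nonneg_nonneg z ctr_nonneg) auto
  then have "t * S \<le> ?v * (\<Sum>j\<in>?J. z j * ctr I j)"
    using t by (intro mult_mono) (auto intro!: sum_nonneg mult_nonneg_nonneg z ctr_nonneg simp: S_def)
  then have tS: "ereal (t * S) \<le> budget I i"
    using budget by (meson ereal_less_eq(3) order_trans)
  have S0: "0 \<le> S"
    unfolding S_def by (intro sum_nonneg mult_nonneg_nonneg z ctr_nonneg) auto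
  have "(?v - t) * S \<le> expectation (utility I i)"
  \<comment> \<open>\<open>S \<le> ?G\<close> forces \<open>S = 0\<close> when
    \<open>?G = 0\<close>; otherwise \<open>S / ?G\<close> is a probability and the expected payment
    is \<open>t * S\<close>.\<close>
  proof (cases "?G = 0")
    case True
    then show ?thesis
      using SG S0 expectation_utility_ge[OF i, of 0 0] budget_pos[OF i] by (simp add: zero_ereal_def less_imp_le)
  next
    case False
    then have G: "0 < ?G" using clicks_at_nonneg[of i t] by simp
    have "S / ?G * (?v - t) * ?G \<le> expectation (utility I i)"
      by (rule expectation_utility_ge[OF i t(1)]) (use G S0 SG tS in \<open>auto simp: mult_ac\<close>)
    then show ?thesis using G by (simp add: mult_ac)
  qed
  then show ?thesis by (simp add: S_def)
qed

text \<open>A target worth more than the budget is first scaled down to value exactly \<open>budget I i\<close>.\<close>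

lemma utility_ge_target:
  assumes w: "- 1 < w" "w < 0" "w * exp w = - exp (- 2 :: real)"
    and i: "i \<in> N" and z: "\<And>j. j \<in> {1..slots I} \<Longrightarrow> 0 \<le> z j" "(\<Sum>j\<in>{1..slots I}. z j) \<le> 1"
    and W: "ereal W = min (ereal (click_value I i * (\<Sum>j\<in>{1..slots I}. z j * ctr I j))) (budget I i)"
  shows "(1 + w) / (2 + w) * W
      - 1 / (2 + w) * (\<Sum>j\<in>{1..slots I}. z j * ctr I j * expectation (position_bid j))
    \<le> expectation (utility I i)"
proof -
  let ?J = "{1..slots I}" and ?v = "click_value I i"
  let ?y = "\<Sum>j\<in>?J. z j * ctr I j"
  have W_le: "W \<le> ?v * ?y" "ereal W \<le> budget I i"
    using W by (metis ereal_less_eq(3) min.cobounded1, metis min.cobounded2)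
  have y: "0 \<le> ?v * ?y"
    by (intro mult_nonneg_nonneg click_value_nonneg i sum_nonneg z ctr_nonneg) auto
  have W0: "0 \<le> W"
    using W y budget_pos[OF i] by (metis ereal_less_eq(5) less_imp_le min.boundedI)
  \<comment> \<open>\<open>s\<close> is the scaling factor: the ratio of \<open>W\<close> to the
    target value, or \<open>0\<close> when that value, and hence \<open>W\<close>, is zero.\<close>
  obtain s where s: "0 \<le> s" "s \<le> 1" "s * (?v * ?y) = W"
  proof (cases "?v * ?y = 0")
    case True
    then have "W = 0" using W_le(1) W0 by linarith
    then show ?thesis using that[of 0] by simp
  next
    case False
    then have "0 < ?v * ?y" using y by linarith
    then show ?thesis
      by (intro that[of "W / (?v * ?y)"]) (use W_le(1) W0 in \<open>auto simp: divide_le_eq_1 simp del: zero_less_mult_iff\<close>)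
  qed
  have sy: "(\<Sum>j\<in>?J. s * z j * ctr I j) = s * ?y"
    by (simp add: sum_distrib_left mult.assoc)
  have target: "?v * (\<Sum>j\<in>?J. s * z j * ctr I j) = W"
    unfolding sy using s(3) by (simp only: mult.left_commute)
  have "0 \<le> (\<Sum>j\<in>?J. z j)" by (intro sum_nonneg z)
  then have sz: "(\<Sum>j\<in>?J. s * z j) \<le> 1"
    using s(2) z(2) by (simp add: sum_distrib_left[symmetric] mult_le_one)
  have E: "0 \<le> expectation (position_bid j)" for j
    by (intro integral_nonneg_AE AE_I2) (simp add: position_bid_nonneg space_A)
  have "(1 + w) / (2 + w) * (?v * (\<Sum>j\<in>?J. s * z j * ctr I j))
      - 1 / (2 + w) * (\<Sum>j\<in>?J. s * z j * ctr I j * expectation (position_bid j))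
    \<le> expectation (utility I i)"
  proof (rule utility_ge_of_bid_utilities[OF w])
    fix t assume t: "0 \<le> t" "t \<le> ?v"
    show "(?v - t) * (\<Sum>j\<in>?J. s * z j * ctr I j * prob {a \<in> space A. position_bid j a < t})
        \<le> expectation (utility I i)"
    proof (rule utility_ge_scaled_bid[OF i _ sz _ t])
      show "ereal (?v * (\<Sum>j\<in>?J. s * z j * ctr I j)) \<le> budget I i"
        unfolding target by (rule W_le(2))
    qed (use s z in auto)
  qed (use s z ctr_nonneg integrable_position_bid position_bid_nonneg click_value_nonneg[OF i]
       in \<open>auto simp: space_A\<close>)
  \<comment> \<open>Undoing the scaling only enlarges the subtracted term, as
    \<open>s \<le> 1\<close>.\<close>
  moreover have "(\<Sum>j\<in>?J. s * z j * ctr I j * expectation (position_bid j))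
      \<le> (\<Sum>j\<in>?J. z j * ctr I j * expectation (position_bid j))"
    using s z ctr_nonneg E by (intro sum_mono mult_right_mono mult_left_le_one_le) auto
  then have "1 / (2 + w) * (\<Sum>j\<in>?J. s * z j * ctr I j * expectation (position_bid j))
      \<le> 1 / (2 + w) * (\<Sum>j\<in>?J. z j * ctr I j * expectation (position_bid j))"
    using w by (intro mult_left_mono) auto
  ultimately show ?thesis unfolding target by linarith
qed

section \<open>From utilities to liquid welfare\<close>

abbreviation bidder_welfare :: "nat \<Rightarrow> ereal" where
  "bidder_welfare i \<equiv> min (ereal (expectation (\<lambda>a. valuation I i (slot_of I i a)))) (budget I i)"

text \<open>Below the budget, \<open>L\<close> is utility plus payment and the utility bound
  applies; otherwise \<open>L\<close> equals the budget, which dominates both \<open>W\<close> and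
  the payment. The bracket is kept because it sums to something nonpositive over all
  bidders.\<close>

lemma target_le_bidder_welfare:
  assumes w: "- 1 < w" "w < 0" "w * exp w = - exp (- 2 :: real)"
    and i: "i \<in> N" and z: "\<And>j. j \<in> {1..slots I} \<Longrightarrow> 0 \<le> z j" "(\<Sum>j\<in>{1..slots I}. z j) \<le> 1"
    and W: "ereal W = min (ereal (click_value I i * (\<Sum>j\<in>{1..slots I}. z j * ctr I j))) (budget I i)"
    and L: "ereal L = bidder_welfare i"
  shows "W \<le> (2 + w) / (1 + w) * L
      + 1 / (1 + w) * ((\<Sum>j\<in>{1..slots I}. z j * ctr I j * expectation (position_bid j))
          - expectation (payment I i))"
proof -
  let ?r = "\<Sum>j\<in>{1..slots I}. z j * ctr I j * expectation (position_bid j)"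
  let ?p = "expectation (payment I i)" and ?V = "expectation (\<lambda>a. valuation I i (slot_of I i a))"
  have p0: "0 \<le> ?p" by (rule expectation_payment_nonneg[OF i])
  have "(1 + w) * W \<le> (2 + w) * L + ?r - ?p"
  proof (cases "ereal ?V < budget I i")
    case True
    then have "L = ?V" using L by (simp add: min_def split: if_splits)
    then have U: "expectation (utility I i) = L - ?p"
      using expectation_payment[OF i] by simp
    have "(1 + w) / (2 + w) * W - 1 / (2 + w) * ?r \<le> expectation (utility I i)"
      by (rule utility_ge_target[OF w i z W])
    then have "((1 + w) * W - ?r) / (2 + w) \<le> L - ?p"
      by (simp add: U diff_divide_distrib)
    then have "(1 + w) * W - ?r \<le> (L - ?p) * (2 + w)"
      using w by (simp only: pos_divide_le_eq)
    \<comment> \<open>Clearing the denominator yields \<open>2 + w\<close> copies of the payment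
      where one suffices; the surplus is discarded.\<close>
    moreover have "0 \<le> (1 + w) * ?p" using p0 w by simp
    ultimately show ?thesis by (simp add: algebra_simps)
  next
    case False
    then have B: "ereal L = budget I i" using L by (simp add: min_def not_less split: if_splits)
    have "W \<le> L" using W B by (metis ereal_less_eq(3) min.cobounded2)
    moreover have "?p \<le> L" using expectation_payment_le_budget[OF i] B by (metis ereal_less_eq(3))
    moreover have "0 \<le> ?r"
      using z(1) by (intro sum_nonneg mult_nonneg_nonneg ctr_nonneg integral_nonneg_AE AE_I2)
        (auto simp: position_bid_nonneg space_A)
    \<comment> \<open>Of the \<open>2 + w\<close> copies of \<open>L\<close>, \<open>1 + w\<close>
      cover the target and the remaining one covers the payment.\<close>
    ultimately show ?thesis
      using w mult_left_mono[of W L "1 + w"] by (simp add: algebra_simps)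
  qed
  then have "W \<le> ((2 + w) * L + ?r - ?p) / (1 + w)"
    using w by (simp add: pos_le_divide_eq mult.commute)
  then show ?thesis
    using add_divide_distrib[of "(2 + w) * L" "?r - ?p" "1 + w"] by (simp add: add_diff_eq)
qed

text \<open>A random allocation matters only through its marginals \<open>z i j\<close>. Row sums at
  most one make each bidder's target admissible; column sums at most one bound the summed position
  bids by the revenue.\<close>

lemma pmf_allocation_le:
  assumes w: "- 1 < w" "w < 0" "w * exp w = - exp (- 2 :: real)"
    and p: "set_pmf p \<subseteq> feasible_allocations I"
  shows "(\<Sum>i\<in>N. min (expect (measure_pmf p) (\<lambda>x. valuation I i (x i))) (budget I i))
    \<le> ereal ((2 + w) / (1 + w)) * liquid_welfare I A"
proof -
  let ?J = "{1..slots I}"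
  define z where "z i j = measure_pmf.prob p {x. x i = j}" for i j
  have range: "x i \<in> {0..slots I}" if "x \<in> set_pmf p" "i \<in> N" for x i
    using p that unfolding feasible_allocations_def by (blast dest: PiE_mem)
  have row: "(\<Sum>j\<in>?J. z i j) \<le> 1" for i
  proof -
    have "(\<Sum>j\<in>?J. z i j) = measure_pmf.prob p (\<Union>j\<in>?J. {x. x i = j})"
      unfolding z_def by (rule measure_pmf.finite_measure_finite_Union[symmetric]) (auto simp: disjoint_family_on_def)
    then show ?thesis by simp
  qed
  have column: "(\<Sum>i\<in>N. z i j) \<le> 1" if "j \<in> ?J" for j
  proof -
    \<comment> \<open>Two bidders cannot share slot \<open>j\<close> on the support, so intersecting
      with it makes the events disjoint.\<close>
    have "z i j = measure_pmf.prob p ({x. x i = j} \<inter> set_pmf p)" for i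
      unfolding z_def by (simp add: measure_Int_set_pmf)
    then have "(\<Sum>i\<in>N. z i j) = (\<Sum>i\<in>N. measure_pmf.prob p ({x. x i = j} \<inter> set_pmf p))" by simp
    also have "\<dots> = measure_pmf.prob p (\<Union>i\<in>N. {x. x i = j} \<inter> set_pmf p)"
    proof (rule measure_pmf.finite_measure_finite_Union[symmetric])
      have "k = i" if "x \<in> set_pmf p" "i \<in> N" "k \<in> N" "x i = j" "x k = j" for x i k
        using that p \<open>j \<in> ?J\<close> unfolding feasible_allocations_def by force
      then show "disjoint_family_on (\<lambda>i. {x. x i = j} \<inter> set_pmf p) N"
        unfolding disjoint_family_on_def by blast
    qed auto
    finally show ?thesis by simp
  qed
  have target: "expect (measure_pmf p) (\<lambda>x. valuation I i (x i)) =
      ereal (click_value I i * (\<Sum>j\<in>?J. z i j * ctr I j))" if i: "i \<in> N" for i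
  proof -
    \<comment> \<open>For \<open>x i = 0\<close> all indicators on the right vanish, in agreement
      with \<open>ctr I 0 = 0\<close>.\<close>
    have ind: "valuation I i (x i) =
        click_value I i * (\<Sum>j\<in>?J. indicator {x. x i = j} x * ctr I j)" if "x \<in> set_pmf p" for x
    proof -
      have "(\<Sum>j\<in>?J. indicator {x. x i = j} x * ctr I j) = (\<Sum>j\<in>?J. if j = x i then ctr I j else 0)"
        by (intro sum.cong) (auto simp: indicator_def)
      then show ?thesis
        using range[OF that i] inst by (auto simp: valuation_def gfp_instance_def not_less_eq_eq)
    qed
    have int: "integrable (measure_pmf p) (\<lambda>x. indicator {x. x i = j} x * ctr I j)" for j
      by (intro integrable_mult_left measure_pmf.integrable_const_bound[where B = 1])
         (auto simp: indicator_def)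
    let ?g = "\<lambda>x. click_value I i * (\<Sum>j\<in>?J. indicator {x. x i = j} x * ctr I j)"
    have int_g: "integrable (measure_pmf p) ?g"
      by (intro integrable_mult_right Bochner_Integration.integrable_sum int)
    \<comment> \<open>Only on the support is \<open>x i\<close> known to be within
      \<open>{0..slots I}\<close>, so the identity is transferred almost everywhere.\<close>
    have eq: "AE x in measure_pmf p. ?g x = valuation I i (x i)"
      unfolding AE_measure_pmf_iff by (intro ballI ind[symmetric])
    have "integrable (measure_pmf p) (\<lambda>x. valuation I i (x i))"
      by (rule integrable_cong_AE_imp[OF int_g _ eq]) simp
    moreover have "integral\<^sup>L (measure_pmf p) ?g = (\<integral>x. valuation I i (x i) \<partial>measure_pmf p)"
      by (rule integral_cong_AE[OF _ _ eq]) simp_all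
    moreover have "(\<integral>x. click_value I i * (\<Sum>j\<in>?J. indicator {x. x i = j} x * ctr I j) \<partial>measure_pmf p)
        = click_value I i * (\<Sum>j\<in>?J. z i j * ctr I j)"
      by (subst integral_mult_right_zero, subst Bochner_Integration.integral_sum[OF int]) (simp_all add: z_def)
    ultimately show ?thesis by (simp add: expect_eq_integral)
  qed
  \<comment> \<open>The minima are finite: one argument is real and the budget is positive, so
    passing to reals loses nothing.\<close>
  define W where "W i = real_of_ereal
    (min (ereal (click_value I i * (\<Sum>j\<in>?J. z i j * ctr I j))) (budget I i))" for i
  define L where "L i = real_of_ereal (bidder_welfare i)" for i
  have W: "ereal (W i) = min (ereal (click_value I i * (\<Sum>j\<in>?J. z i j * ctr I j))) (budget I i)"
    and L: "ereal (L i) = bidder_welfare i" if "i \<in> N" for i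
    using budget_pos[OF that] unfolding W_def L_def by (cases "budget I i"; simp add: min_def)+
  have z0: "0 \<le> z i j" for i j by (simp add: z_def)
  let ?E = "\<lambda>j. ctr I j * expectation (position_bid j)"
  have "(\<Sum>i\<in>N. \<Sum>j\<in>?J. z i j * ctr I j * expectation (position_bid j)) = (\<Sum>j\<in>?J. (\<Sum>i\<in>N. z i j) * ?E j)"
    by (subst sum.swap) (simp add: sum_distrib_right mult.assoc)
  also have "\<dots> \<le> (\<Sum>j\<in>?J. ?E j)"
    using column z0
    by (intro sum_mono mult_left_le_one_le mult_nonneg_nonneg ctr_nonneg integral_nonneg_AE AE_I2 sum_nonneg)
       (auto simp: position_bid_nonneg space_A)
  also have "\<dots> = (\<Sum>i\<in>N. expectation (payment I i))"
    by (rule sum_expectation_payment[symmetric])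
  finally have revenue: "(\<Sum>i\<in>N. (\<Sum>j\<in>?J. z i j * ctr I j * expectation (position_bid j)) - expectation (payment I i)) \<le> 0"
    by (simp add: sum_subtractf)
  have "(\<Sum>i\<in>N. W i) \<le> (\<Sum>i\<in>N. (2 + w) / (1 + w) * L i + 1 / (1 + w) *
      ((\<Sum>j\<in>?J. z i j * ctr I j * expectation (position_bid j)) - expectation (payment I i)))"
    by (intro sum_mono target_le_bidder_welfare[OF w _ z0 row W L])
  also have "\<dots> = (2 + w) / (1 + w) * (\<Sum>i\<in>N. L i) + 1 / (1 + w) *
      (\<Sum>i\<in>N. (\<Sum>j\<in>?J. z i j * ctr I j * expectation (position_bid j)) - expectation (payment I i))"
    by (simp only: sum.distrib sum_distrib_left)
  also have "\<dots> \<le> (2 + w) / (1 + w) * (\<Sum>i\<in>N. L i)"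
    using revenue w by (simp add: divide_nonpos_pos)
  finally have "ereal (\<Sum>i\<in>N. W i) \<le> ereal ((2 + w) / (1 + w)) * ereal (\<Sum>i\<in>N. L i)"
    by simp
  moreover have "liquid_welfare I A = ereal (\<Sum>i\<in>N. L i)"
    unfolding liquid_welfare_def sum_ereal[symmetric]
    by (intro sum.cong) (auto simp: L expect_eq_integral integrable_valuation)
  moreover have "(\<Sum>i\<in>N. min (expect (measure_pmf p) (\<lambda>x. valuation I i (x i))) (budget I i)) = ereal (\<Sum>i\<in>N. W i)"
    unfolding sum_ereal[symmetric] by (intro sum.cong) (auto simp: W target)
  ultimately show ?thesis by simp
qed

lemma liquid_welfare_nonneg: "0 \<le> liquid_welfare I A"
  unfolding liquid_welfare_def
proof (intro sum_nonneg min.boundedI)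
  fix i assume i: "i \<in> N"
  have "0 \<le> expectation (\<lambda>a. valuation I i (slot_of I i a))"
    unfolding valuation_def using click_value_nonneg[OF i] ctr_slot_nonneg by simp
  then show "0 \<le> expect A (\<lambda>a. valuation I i (slot_of I i a))"
    by (simp add: expect_eq_integral integrable_valuation[OF i])
  show "0 \<le> budget I i" using budget_pos[OF i] by simp
qed

end

theorem theorem6p1:
  shows "price_of_anarchy
           \<le> ereal ((2 + lambert_W0 (- exp (- 2))) / (1 + lambert_W0 (- exp (- 2)))) \<and>
         (\<forall>I A. gfp_instance I \<longrightarrow> coarse_correlated_eq I A \<longrightarrow>
            opt_liquid_welfare I
              \<le> ereal ((2 + lambert_W0 (- exp (- 2))) / (1 + lambert_W0 (- exp (- 2))))
                 * liquid_welfare I A)"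
proof -
  let ?w = "lambert_W0 (- exp (- 2))"
  let ?c = "ereal ((2 + ?w) / (1 + ?w))"
  note w = lambert_W0_exp_minus_2_gt lambert_W0_exp_minus_2(2,3)
  have c: "0 \<le> ?c" using w by simp
  have bound: "opt_liquid_welfare I \<le> ?c * liquid_welfare I A" "0 \<le> liquid_welfare I A"
    if "gfp_instance I" "coarse_correlated_eq I A" for I A
  proof -
    interpret gfp_equilibrium I A
      using that by unfold_locales (auto simp: coarse_correlated_eq_def)
    show "opt_liquid_welfare I \<le> ?c * liquid_welfare I A"
      unfolding opt_liquid_welfare_def by (intro SUP_least pmf_allocation_le[OF w]) (simp only: mem_Collect_eq)
    show "0 \<le> liquid_welfare I A" by (rule liquid_welfare_nonneg)
  qed
  have "opt_liquid_welfare I / liquid_welfare I A \<le> ?c"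
    if eq: "gfp_instance I" "coarse_correlated_eq I A" for I A
  \<comment> \<open>A zero denominator forces a nonpositive optimum, so the quotient is
    \<open>0\<close> or minus infinity; an infinite denominator makes it \<open>0\<close>.\<close>
  proof (cases "liquid_welfare I A = 0 \<or> liquid_welfare I A = \<infinity>")
    case True
    then show ?thesis
      using bound[OF eq] c by (cases "opt_liquid_welfare I") (auto simp: divide_ereal_def)
  next
    case False
    then have "0 < liquid_welfare I A" using bound(2)[OF eq] by (simp add: order_less_le)
    then show ?thesis using bound(1)[OF eq] False
      by (cases "liquid_welfare I A"; cases "opt_liquid_welfare I") (auto simp: divide_ereal_def field_simps)
  qed
  then show ?thesis
    unfolding price_of_anarchy_def using bound(1) by (auto intro!: Sup_least)
qed

end
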